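(* Let $\gamma>0$ and let $F$ be a distribution function on $\mathbb{R}$ with $F\in\mathcal{S}_\gamma$ and $\hat\varphi_F<1$. Let $\{\xi_n\}_{n\ge1}$ be i.i.d. random variables with distribution function $F$, and let $S_n$, $M_n$, $M$ and the events $A_n^{a,x}$ be defined from $\{\xi_n\}$ as in the context. Then, given $\epsilon>0$, there exists $a>0$ such that $$(1-\epsilon)\frac{\mathbf{E} e^{\gamma M}}{1-\hat\varphi_F}\le\liminf_{x\to\infty}\frac{1}{\overline{F}(x)}\mathbf{P}\biggl(M>x,\,\bigcup_{n\ge1}A_n^{a,x-a}\biggr)\le\lim_{x\to\infty}\frac{\mathbf{P}(M>x)}{\overline{F}(x)}=\frac{\mathbf{E} e^{\gamma M}}{1-\hat\varphi_F},$$ where in particular the limit in the third expression exists.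
   Context: For a distribution function $F$ on $\mathbb{R}$, let $\overline{F}(x)=1-F(x)$, let $\varphi_F(\alpha)=\int_{-\infty}^\infty e^{\alpha x}\,dF(x)\in[0,\infty]$ for $\alpha\ge0$, and let $F^{*2}$ be the convolution of $F$ with itself. For $\gamma\ge0$, $F\in\mathcal{L}_\gamma$ if and only if $\overline{F}(x)>0$ for all $x$ and $\lim_{x\to\infty}\overline{F}(x-k)/\overline{F}(x)=e^{\gamma k}$ for every fixed $k\in\mathbb{R}$. For $F\in\mathcal{L}_\gamma$ write $\hat\varphi_F=\varphi_F(\gamma)$ (possibly infinite). $F\in\mathcal{S}_\gamma$ if and only if $F\in\mathcal{L}_\gamma$, $\hat\varphi_F<\infty$, and $\overline{F^{*2}}(x)\sim 2\hat\varphi_F\overline{F}(x)$ as $x\to\infty$, i.e. the ratio of the two sides tends to $1$. Random walk: $S_0=0$, $S_n=\sum_{i=1}^n\xi_i$ for $n\ge1$; $M_n=\max_{0\le i\le n}S_i$ for $n\ge0$; $M=\sup_{n\ge0}S_n$ (almost surely finite when $\gamma>0$ and $\hat\varphi_F<1$). For $x\ge a\ge0$ and $n\ge1$, $A_n^{a,x}=\{M_{n-1}\le a,\ S_n>x\}$; thus $A_n^{a,x-a}=\{M_{n-1}\le a,\ S_n>x-a\}$ for $x\ge2a$. *)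

theory Defs
  imports "HOL-Probability.Probability" "HOL-Library.Landau_Symbols"
begin

definition distribution_function :: "(real \<Rightarrow> real) \<Rightarrow> bool" where
  "distribution_function F \<longleftrightarrow>
     mono F \<and> (\<forall>a. continuous (at_right a) F) \<and> (F \<longlongrightarrow> 0) at_bot \<and> (F \<longlongrightarrow> 1) at_top"

definition tail :: "(real \<Rightarrow> real) \<Rightarrow> real \<Rightarrow> real" where
  "tail F x = 1 - F x"

definition mgf :: "(real \<Rightarrow> real) \<Rightarrow> real \<Rightarrow> ennreal" where
  "mgf F \<alpha> = (\<integral>\<^sup>+x. ennreal (exp (\<alpha> * x)) \<partial>interval_measure F)"

definition conv_square :: "(real \<Rightarrow> real) \<Rightarrow> real \<Rightarrow> real" where
  "conv_square F = cdf (interval_measure F \<star> interval_measure F)"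

definition class_L :: "real \<Rightarrow> (real \<Rightarrow> real) set" where
  "class_L \<gamma> = {F. distribution_function F \<and> (\<forall>x. tail F x > 0) \<and>
     (\<forall>k. ((\<lambda>x. tail F (x - k) / tail F x) \<longlongrightarrow> exp (\<gamma> * k)) at_top)}"

definition class_S :: "real \<Rightarrow> (real \<Rightarrow> real) set" where
  "class_S \<gamma> = {F. F \<in> class_L \<gamma> \<and> mgf F \<gamma> < \<infinity> \<and>
     tail (conv_square F) \<sim>[at_top] (\<lambda>x. 2 * enn2real (mgf F \<gamma>) * tail F x)}"

text \<open>The increments are \<open>\<xi> 1, \<xi> 2, \<dots>\<close>; the value \<open>\<xi> 0\<close> is never used.\<close>

definition walk :: "(nat \<Rightarrow> 'a \<Rightarrow> real) \<Rightarrow> nat \<Rightarrow> 'a \<Rightarrow> real" where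
  "walk \<xi> n \<omega> = (\<Sum>i=1..n. \<xi> i \<omega>)"

definition walk_max :: "(nat \<Rightarrow> 'a \<Rightarrow> real) \<Rightarrow> nat \<Rightarrow> 'a \<Rightarrow> real" where
  "walk_max \<xi> n \<omega> = Max ((\<lambda>i. walk \<xi> i \<omega>) ` {0..n})"

text \<open>The global supremum is only almost surely finite, so it is extended-real valued.\<close>

definition walk_sup :: "(nat \<Rightarrow> 'a \<Rightarrow> real) \<Rightarrow> 'a \<Rightarrow> ereal" where
  "walk_sup \<xi> \<omega> = (SUP n. ereal (walk \<xi> n \<omega>))"

definition exp_ereal :: "ereal \<Rightarrow> ennreal" where
  "exp_ereal x = (case x of ereal r \<Rightarrow> ennreal (exp r) | PInfty \<Rightarrow> \<infinity> | MInfty \<Rightarrow> 0)"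

definition crossing_event ::
  "'a measure \<Rightarrow> (nat \<Rightarrow> 'a \<Rightarrow> real) \<Rightarrow> nat \<Rightarrow> real \<Rightarrow> real \<Rightarrow> 'a set" where
  "crossing_event P \<xi> n a y = {\<omega> \<in> space P. walk_max \<xi> (n - 1) \<omega> \<le> a \<and> walk \<xi> n \<omega> > y}"

end

(* By stationarity P(M > x) = P(xi + M > x) for x >= 0, with M independent of xi. Splitting on
   M <= A or M > A bounds this by E[Fbar(x - M); M <= A] + C * P(xi + xi' > x, xi' > A) whenever
   P(M > y) <= C * Fbar(y) for y >= A. Divided by Fbar(x), the last probability tends to
   2 phi - E[exp(gamma xi); xi <= A], which is close to phi < 1 for large A. Applied to the finite
   maxima M_n this first gives P(M > x) = O(Fbar(x)); applied to M it shows that the best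
   asymptotic constant C satisfies C <= E exp(gamma M) + phi * C.
   For the lower bound, let the walk stay below a for j steps, then make one big jump after which
   it gains at most a. Integrating out the jump, this contributes asymptotically
   E[exp(gamma S_j); M_j <= a] * E[exp(gamma M); M <= a], which tends to phi^j * E exp(gamma M)
   as a grows, and these events are disjoint in j. *)

theory Submission
  imports Defs
begin

section \<open>Fubini for probabilities, and removal of truncations\<close>

lemma measure_pair_eq_integral:
  assumes "prob_space M" "prob_space N" "X \<in> sets (M \<Otimes>\<^sub>M N)"
  shows "measure (M \<Otimes>\<^sub>M N) X = (\<integral>x. measure N (Pair x -` X) \<partial>M)"
    and "measure (M \<Otimes>\<^sub>M N) X = (\<integral>y. measure M ((\<lambda>x. (x, y)) -` X) \<partial>N)"
proof -
  interpret M: prob_space M by fact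
  interpret N: prob_space N by fact
  interpret pair_prob_space M N ..
  note [measurable] = assms(3)
  have "ennreal (measure (M \<Otimes>\<^sub>M N) X) = (\<integral>\<^sup>+x. ennreal (measure N (Pair x -` X)) \<partial>M)"
    by (simp add: emeasure_eq_measure[symmetric] N.emeasure_eq_measure[symmetric]
        N.emeasure_pair_measure_alt)
  also have "(\<lambda>x. measure N (Pair x -` X)) \<in> borel_measurable M"
    unfolding measure_def using N.measurable_emeasure_Pair[OF assms(3)] by measurable
  hence "(\<integral>\<^sup>+x. ennreal (measure N (Pair x -` X)) \<partial>M) = ennreal (\<integral>x. measure N (Pair x -` X) \<partial>M)"
    by (intro nn_integral_eq_integral M.integrable_const_bound[where B = 1]) auto
  finally show "measure (M \<Otimes>\<^sub>M N) X = (\<integral>x. measure N (Pair x -` X) \<partial>M)"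
    by (simp add: integral_nonneg)
  have "ennreal (measure (M \<Otimes>\<^sub>M N) X) = (\<integral>\<^sup>+y. ennreal (measure M ((\<lambda>x. (x, y)) -` X)) \<partial>N)"
    by (simp add: emeasure_eq_measure[symmetric] M.emeasure_eq_measure[symmetric]
        emeasure_pair_measure_alt2)
  also have "(\<lambda>y. measure M ((\<lambda>x. (x, y)) -` X)) \<in> borel_measurable N"
    unfolding measure_def using measurable_emeasure_Pair2[OF assms(3)] by measurable
  hence "(\<integral>\<^sup>+y. ennreal (measure M ((\<lambda>x. (x, y)) -` X)) \<partial>N)
    = ennreal (\<integral>y. measure M ((\<lambda>x. (x, y)) -` X) \<partial>N)"
    by (intro nn_integral_eq_integral N.integrable_const_bound[where B = 1]) auto
  finally show "measure (M \<Otimes>\<^sub>M N) X = (\<integral>y. measure M ((\<lambda>x. (x, y)) -` X) \<partial>N)"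
    by (simp add: integral_nonneg)
qed

text \<open>Dominated convergence with majorant \<open>norm (f \<omega>)\<close>. It is the tool for
  sending a truncation level to infinity, for a single increment, for a partial sum and for the
  supremum.\<close>

lemma tendsto_integral_exhaustion_at_top:
  fixes f :: "'b \<Rightarrow> real"
  assumes f: "integrable N f" and E: "\<And>a::real. E a \<in> sets N"
    and ev: "AE \<omega> in N. \<forall>\<^sub>F a in at_top. \<omega> \<in> E a"
  shows "((\<lambda>a. \<integral>\<omega>. indicator (E a) \<omega> * f \<omega> \<partial>N) \<longlongrightarrow> (\<integral>\<omega>. f \<omega> \<partial>N)) at_top"
proof (rule integral_dominated_convergence_at_top[where w = "\<lambda>\<omega>. norm (f \<omega>)"])
  show "AE \<omega> in N. ((\<lambda>a. indicator (E a) \<omega> * f \<omega>) \<longlongrightarrow> f \<omega>) at_top"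
    using ev by eventually_elim (auto intro!: tendsto_eventually elim!: eventually_mono)
qed (use f E in \<open>auto simp: indicator_def\<close>)

section \<open>Partial sums of a real sequence and their supremum\<close>

text \<open>Increments are numbered from 0 here, and from 1 in \<open>walk\<close>; the shift lets
  sequences be points of a product space over all of \<open>nat\<close>.\<close>

definition psum :: "(nat \<Rightarrow> real) \<Rightarrow> nat \<Rightarrow> real" where
  "psum \<omega> n = (\<Sum>i<n. \<omega> i)"

definition psup :: "(nat \<Rightarrow> real) \<Rightarrow> ereal" where
  "psup \<omega> = (SUP n. ereal (psum \<omega> n))"

text \<open>\<open>real_of_ereal\<close> returns 0 where the supremum is infinite. That set is null
  by \<open>AE_psup_finite\<close>, and truncation to \<open>psup \<omega> \<le> ereal A\<close>
  excludes it outright.\<close>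

definition peak :: "(nat \<Rightarrow> real) \<Rightarrow> real" where
  "peak \<omega> = real_of_ereal (psup \<omega>)"

lemma psum_0 [simp]: "psum \<omega> 0 = 0"
  by (simp add: psum_def)

lemma psum_case_nat [simp]: "psum (case_nat z \<omega>) (Suc n) = z + psum \<omega> n"
  unfolding psum_def by (subst sum.lessThan_Suc_shift) simp

lemma psum_comb_seq_le: "k \<le> n \<Longrightarrow> psum (comb_seq n \<omega> \<omega>') k = psum \<omega> k"
  by (simp add: psum_def comb_seq_less)

lemma psum_comb_seq_add: "psum (comb_seq n \<omega> \<omega>') (n + k) = psum \<omega> n + psum \<omega>' k"
proof (induction k)
  case (Suc k)
  show ?case
    using Suc comb_seq_add[of n \<omega> \<omega>' k] by (simp add: psum_def add.commute)
qed (simp add: psum_comb_seq_le)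

lemma psup_le_iff: "psup \<omega> \<le> ereal a \<longleftrightarrow> (\<forall>k. psum \<omega> k \<le> a)"
  by (auto simp: psup_def SUP_le_iff)

lemma less_psup_iff: "ereal a < psup \<omega> \<longleftrightarrow> (\<exists>k. psum \<omega> k > a)"
  by (auto simp: psup_def less_SUP_iff)

lemma psup_nonneg: "0 \<le> psup \<omega>"
  unfolding psup_def by (rule SUP_upper2[of 0]) auto

lemma psup_eq_peak: "psup \<omega> \<noteq> \<infinity> \<Longrightarrow> psup \<omega> = ereal (peak \<omega>)"
  using psup_nonneg[of \<omega>] by (cases "psup \<omega>") (auto simp: peak_def)

lemma borel_measurable_psum [measurable]:
  "(\<lambda>\<omega>. psum \<omega> n) \<in> borel_measurable (\<Pi>\<^sub>M i\<in>UNIV. borel)"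
  unfolding psum_def by measurable

lemma borel_measurable_psup [measurable]: "psup \<in> borel_measurable (\<Pi>\<^sub>M i\<in>UNIV. borel)"
  unfolding psup_def by measurable

lemma borel_measurable_peak [measurable]: "peak \<in> borel_measurable (\<Pi>\<^sub>M i\<in>UNIV. borel)"
  unfolding peak_def by measurable

text \<open>A finite bound \<open>t\<close> on all exponentials bounds every partial sum by
  \<open>ln t / \<gamma>\<close>, hence also the supremum, which is then a real number. With
  \<open>T\<close> a series this dominates exp(\<gamma> M) by the sum of all exp(\<gamma>
  S_n).\<close>

lemma exp_ereal_psup_le:
  assumes "\<gamma> > 0" and T: "\<And>n. ennreal (exp (\<gamma> * psum \<omega> n)) \<le> T"
  shows "exp_ereal (ereal \<gamma> * psup \<omega>) \<le> T"
proof (cases T)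
  case (real t)
  have t: "1 \<le> t"
    using T[of 0] real by simp
  have "psum \<omega> n \<le> ln t / \<gamma>" for n
  proof -
    have "exp (\<gamma> * psum \<omega> n) \<le> t"
      using T[of n] real by simp
    hence "\<gamma> * psum \<omega> n \<le> ln t"
      using t by (subst ln_ge_iff) auto
    thus ?thesis
      using \<open>\<gamma> > 0\<close> by (simp add: field_simps)
  qed
  hence le: "psup \<omega> \<le> ereal (ln t / \<gamma>)"
    by (simp add: psup_le_iff)
  hence eq: "psup \<omega> = ereal (peak \<omega>)"
    by (intro psup_eq_peak) auto
  hence "\<gamma> * peak \<omega> \<le> ln t"
    using le \<open>\<gamma> > 0\<close> by (simp add: field_simps)
  hence "exp (\<gamma> * peak \<omega>) \<le> t"
    using t by (metis exp_le_cancel_iff exp_ln less_le_trans zero_less_one)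
  thus ?thesis
    using real by (simp add: eq exp_ereal_def ennreal_leI)
qed simp

section \<open>The increment law and the sequence space of i.i.d. increments\<close>

locale conv_equiv_walk =
  fixes F :: "real \<Rightarrow> real" and \<gamma> :: real
  assumes \<gamma>_pos: "\<gamma> > 0" and F_S: "F \<in> class_S \<gamma>" and mgf_less_1: "mgf F \<gamma> < 1"
begin

abbreviation \<mu> :: "real measure" where "\<mu> \<equiv> interval_measure F"

definition \<phi> :: real where "\<phi> = enn2real (mgf F \<gamma>)"

lemma mgf_eq: "mgf F \<gamma> = ennreal \<phi>"
  proof -
  have "mgf F \<gamma> < \<top>"
    using mgf_less_1 by (rule less_trans) simp
  thus ?thesis
    by (simp add: \<phi>_def)
qed

lemma \<phi>_nonneg: "0 \<le> \<phi>"
  by (simp add: \<phi>_def)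

lemma \<phi>_less_1: "\<phi> < 1"
  using mgf_less_1 unfolding mgf_eq by (simp add: ennreal_less_one_iff)

lemma F_props:
  shows mono_F: "mono F" and right_cont_F: "\<And>a. continuous (at_right a) F"
    and F_at_bot: "(F \<longlongrightarrow> 0) at_bot" and F_at_top: "(F \<longlongrightarrow> 1) at_top"
    and tail_pos: "\<And>x. tail F x > 0"
    and tail_shift: "\<And>k. ((\<lambda>x. tail F (x - k) / tail F x) \<longlongrightarrow> exp (\<gamma> * k)) at_top"
    and conv_square_equiv: "tail (conv_square F) \<sim>[at_top] (\<lambda>x. 2 * \<phi> * tail F x)"
  using F_S by (auto simp: class_S_def class_L_def distribution_function_def \<phi>_def)

lemma cdf_\<mu>: "cdf \<mu> = F"
  using mono_F right_cont_F F_at_bot by (intro cdf_interval_measure) (auto simp: mono_def)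

lemma real_distribution_\<mu>: "real_distribution \<mu>"
  using mono_F right_cont_F F_at_bot F_at_top
  by (intro real_distribution_interval_measure) (auto simp: mono_def)

sublocale mu: real_distribution \<mu>
  by (rule real_distribution_\<mu>)

sublocale seq: product_prob_space "\<lambda>_. \<mu>" "UNIV :: nat set" ..

sublocale seq: sequence_space \<mu> ..

abbreviation S :: "(nat \<Rightarrow> real) measure" where "S \<equiv> \<Pi>\<^sub>M i\<in>UNIV. \<mu>"

lemma sets_S [measurable_cong]: "sets S = sets (\<Pi>\<^sub>M i\<in>UNIV. borel)"
  by (intro sets_PiM_cong) auto

lemma space_S [simp]: "space S = UNIV"
  by (simp add: space_PiM)

lemma measure_\<mu>_greaterThan: "measure \<mu> {x<..} = tail F x"
proof -
  have "{x<..} = UNIV - {..x}"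
    by auto
  thus ?thesis
    using mu.prob_compl[of "{..x}"] fun_cong[OF cdf_\<mu>, of x] by (simp add: tail_def cdf_def)
qed

lemma tail_antimono: "x \<le> y \<Longrightarrow> tail F y \<le> tail F x"
  using mono_F by (simp add: tail_def mono_def)

lemma tail_le_1: "tail F x \<le> 1"
  by (metis measure_\<mu>_greaterThan mu.prob_le_1)

lemma borel_measurable_tail [measurable]: "tail F \<in> borel_measurable borel"
proof -
  have [measurable]: "F \<in> borel_measurable borel"
    by (rule borel_measurable_mono) (rule mono_F)
  show ?thesis
    unfolding tail_def[abs_def] by measurable
qed

lemma exp_\<mu>: "integrable \<mu> (\<lambda>z. exp (\<gamma> * z))" "(\<integral>z. exp (\<gamma> * z) \<partial>\<mu>) = \<phi>"
proof -
  have "(\<integral>\<^sup>+z. ennreal (exp (\<gamma> * z)) \<partial>\<mu>) = ennreal \<phi>"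
    using mgf_eq by (simp add: mgf_def)
  thus "integrable \<mu> (\<lambda>z. exp (\<gamma> * z))" "(\<integral>z. exp (\<gamma> * z) \<partial>\<mu>) = \<phi>"
    using \<phi>_nonneg by (auto simp: nn_integral_eq_integrable)
qed

section \<open>Tail asymptotics under random shifts and for the convolution square\<close>

text \<open>The pointwise limit is the defining property of \<open>class_L\<close>. Since
  \<open>Y\<close> is at most \<open>A\<close> on \<open>E\<close>, monotonicity bounds the ratio by
  \<open>tail F (x - A) / tail F x\<close>, eventually below \<open>exp (\<gamma> * A) + 1\<close>,
  so dominated convergence applies. The measure is left general to cover one increment, one walk and
  a pair of walks.\<close>

lemma tail_shift_integral:
  fixes Y :: "'b \<Rightarrow> real"
  assumes "finite_measure N" and [measurable]: "E \<in> sets N" "Y \<in> borel_measurable N"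
    and YA: "\<And>\<omega>. \<omega> \<in> E \<Longrightarrow> Y \<omega> \<le> A"
  shows "((\<lambda>x. (\<integral>\<omega>. indicator E \<omega> * tail F (x - Y \<omega>) \<partial>N) / tail F x)
           \<longlongrightarrow> (\<integral>\<omega>. indicator E \<omega> * exp (\<gamma> * Y \<omega>) \<partial>N)) at_top"
proof -
  interpret N: finite_measure N by fact
  have "((\<lambda>x. \<integral>\<omega>. indicator E \<omega> * (tail F (x - Y \<omega>) / tail F x) \<partial>N)
           \<longlongrightarrow> (\<integral>\<omega>. indicator E \<omega> * exp (\<gamma> * Y \<omega>) \<partial>N)) at_top"
  proof (rule integral_dominated_convergence_at_top[where w = "\<lambda>_. exp (\<gamma> * A) + 1"])
    show "AE \<omega> in N. ((\<lambda>x. indicator E \<omega> * (tail F (x - Y \<omega>) / tail F x))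
             \<longlongrightarrow> indicator E \<omega> * exp (\<gamma> * Y \<omega>)) at_top"
      by (intro AE_I2 tendsto_mult_left tail_shift)
    have "\<forall>\<^sub>F x in at_top. tail F (x - A) / tail F x < exp (\<gamma> * A) + 1"
      by (rule order_tendstoD[OF tail_shift]) simp
    thus "\<forall>\<^sub>F x in at_top. AE \<omega> in N.
        norm (indicator E \<omega> * (tail F (x - Y \<omega>) / tail F x)) \<le> exp (\<gamma> * A) + 1"
    proof eventually_elim
      case (elim x)
      show ?case
      proof (rule AE_I2)
        fix \<omega>
        have "tail F (x - Y \<omega>) / tail F x \<le> tail F (x - A) / tail F x" if "\<omega> \<in> E"
          using YA[OF that] tail_pos[of x] by (intro divide_right_mono tail_antimono) auto
        thus "norm (indicator E \<omega> * (tail F (x - Y \<omega>) / tail F x)) \<le> exp (\<gamma> * A) + 1"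
          using elim tail_pos[of x] tail_pos[of "x - Y \<omega>"]
          by (auto simp: indicator_def add_nonneg_nonneg)
      qed
    qed
  qed auto
  thus ?thesis
    by simp
qed

text \<open>For independent increments \<xi> and \<xi>' this is P(\<xi> + \<xi>' > x, \<xi>' > A),
  with \<xi>' integrated out.\<close>

definition conv_tail :: "real \<Rightarrow> real \<Rightarrow> real" where
  "conv_tail A x = (\<integral>z. tail F (max A (x - z)) \<partial>\<mu>)"

definition \<phi>_upto :: "real \<Rightarrow> real" where
  "\<phi>_upto A = (\<integral>z. indicator {..A} z * exp (\<gamma> * z) \<partial>\<mu>)"

lemma \<phi>_upto_tendsto: "(\<phi>_upto \<longlongrightarrow> \<phi>) at_top"
  unfolding \<phi>_upto_def[abs_def]
  using tendsto_integral_exhaustion_at_top[OF exp_\<mu>(1), of "\<lambda>A. {..A}"]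
  by (simp add: exp_\<mu>(2) eventually_ge_at_top)

text \<open>The event that the sum exceeds \<open>x\<close> is split by whether the second summand
  exceeds \<open>A\<close>. The second coordinate is integrated out first when it does, the first
  coordinate when it does not.\<close>

lemma tail_conv_square:
  "tail (conv_square F) x = conv_tail A x + (\<integral>y. indicator {..A} y * tail F (x - y) \<partial>\<mu>)"
proof -
  interpret PP: pair_prob_space \<mu> \<mu> ..
  let ?Q = "\<mu> \<Otimes>\<^sub>M \<mu>"
  let ?X = "\<lambda>B. {p \<in> space ?Q. fst p + snd p > x \<and> snd p \<in> B}"
  have X: "?X B \<in> sets ?Q" if [measurable]: "B \<in> sets borel" for B
    by measurable
  have "tail (conv_square F) x = 1 - measure ?Q {p \<in> space ?Q. fst p + snd p \<le> x}"
    unfolding conv_square_def cdf_def tail_def convolution_def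
    by (subst measure_distr)
       (auto intro!: arg_cong[where f = "measure ?Q"] simp: space_pair_measure split_beta
             simp del: sets_pair_measure_cong)
  also have "\<dots> = measure ?Q (space ?Q - {p \<in> space ?Q. fst p + snd p \<le> x})"
    by (rule PP.prob_compl[symmetric]) measurable
  also have "space ?Q - {p \<in> space ?Q. fst p + snd p \<le> x} = ?X {A<..} \<union> ?X {..A}"
    by (auto simp: space_pair_measure)
  also have "measure ?Q \<dots> = measure ?Q (?X {A<..}) + measure ?Q (?X {..A})"
    by (intro PP.finite_measure_Union X) auto
  also have "measure ?Q (?X {A<..}) = (\<integral>z. measure \<mu> (Pair z -` ?X {A<..}) \<partial>\<mu>)"
    by (intro measure_pair_eq_integral X mu.prob_space_axioms) auto
  also have "\<dots> = conv_tail A x"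
    unfolding conv_tail_def
  proof (intro Bochner_Integration.integral_cong refl)
    fix z
    have "Pair z -` ?X {A<..} = {max A (x - z)<..}"
      by (auto simp: space_pair_measure)
    thus "measure \<mu> (Pair z -` ?X {A<..}) = tail F (max A (x - z))"
      by (simp only: measure_\<mu>_greaterThan)
  qed
  also have "measure ?Q (?X {..A}) = (\<integral>y. measure \<mu> ((\<lambda>z. (z, y)) -` ?X {..A}) \<partial>\<mu>)"
    by (intro measure_pair_eq_integral X mu.prob_space_axioms) auto
  also have "\<dots> = (\<integral>y. indicator {..A} y * tail F (x - y) \<partial>\<mu>)"
  proof (intro Bochner_Integration.integral_cong refl)
    fix y
    have "(\<lambda>z. (z, y)) -` ?X {..A} = (if y \<le> A then {x - y<..} else {})"
      by (auto simp: space_pair_measure)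
    thus "measure \<mu> ((\<lambda>z. (z, y)) -` ?X {..A}) = indicator {..A} y * tail F (x - y)"
      by (simp add: measure_\<mu>_greaterThan)
  qed
  finally show ?thesis .
qed

lemma \<phi>_pos: "0 < \<phi>"
proof -
  have "0 \<noteq> \<phi>"
  proof
    assume "0 = \<phi>"
    hence "AE z in \<mu>. exp (\<gamma> * z) = 0"
      using exp_\<mu> by (subst integral_nonneg_eq_0_iff_AE[symmetric]) auto
    thus False
      by simp
  qed
  thus ?thesis
    using \<phi>_nonneg by simp
qed

text \<open>This is where the convolution condition of \<open>class_S\<close> enters: it gives the
  limit 2 \<phi> for the full convolution tail, and the piece with bounded second summand takes away
  \<open>\<phi>_upto A\<close>. For large \<open>A\<close> the remainder is close to
  \<open>\<phi>\<close>, hence below 1, which makes the later recursion contract.\<close>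

lemma conv_tail_tendsto:
  "((\<lambda>x. conv_tail A x / tail F x) \<longlongrightarrow> 2 * \<phi> - \<phi>_upto A) at_top"
proof -
  have "((\<lambda>x. tail (conv_square F) x / (2 * \<phi> * tail F x)) \<longlongrightarrow> 1) at_top"
    by (rule asymp_equivD_strong[OF conv_square_equiv])
       (use \<phi>_pos tail_pos in \<open>auto simp: less_imp_neq[symmetric]\<close>)
  from tendsto_mult_left[OF this, of "2 * \<phi>"]
  have "((\<lambda>x. tail (conv_square F) x / tail F x) \<longlongrightarrow> 2 * \<phi>) at_top"
    using \<phi>_pos by simp
  moreover have "((\<lambda>x. (\<integral>y. indicator {..A} y * tail F (x - y) \<partial>\<mu>) / tail F x)
      \<longlongrightarrow> \<phi>_upto A) at_top"
    unfolding \<phi>_upto_def by (rule tail_shift_integral[where A = A]) (auto intro: mu.finite_measure_axioms)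
  ultimately show ?thesis
    by (auto dest: tendsto_diff simp: tail_conv_square[of _ A] diff_divide_distrib[symmetric])
qed

section \<open>Exceedance probabilities and the recursion on the first increment\<close>

text \<open>The index set makes one recursion serve both the finite maxima (\<open>{..n}\<close>)
  and the global supremum (\<open>UNIV\<close>).\<close>

definition exceed :: "nat set \<Rightarrow> real \<Rightarrow> (nat \<Rightarrow> real) set" where
  "exceed K x = {\<omega>. \<exists>k\<in>K. psum \<omega> k > x}"

definition exceed_prob :: "nat set \<Rightarrow> real \<Rightarrow> real" where
  "exceed_prob K x = measure S (exceed K x)"

lemma sets_exceed [measurable]: "exceed K x \<in> sets S"
proof -
  have "{\<omega> \<in> space S. \<exists>k\<in>K. psum \<omega> k > x} \<in> sets S"
    by measurable
  thus ?thesis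
    by (simp add: exceed_def)
qed

lemma prob_space_S: "prob_space S"
  by (rule seq.P.prob_space_axioms)

lemma exceed_antimono: "x \<le> y \<Longrightarrow> exceed K y \<subseteq> exceed K x"
  unfolding exceed_def using le_less_trans by blast

lemma exceed_prob_antimono: "x \<le> y \<Longrightarrow> exceed_prob K y \<le> exceed_prob K x"
  unfolding exceed_prob_def by (intro seq.P.finite_measure_mono exceed_antimono sets_exceed)

lemma exceed_prob_nonneg: "0 \<le> exceed_prob K x" and exceed_prob_le_1: "exceed_prob K x \<le> 1"
  by (simp_all add: exceed_prob_def)

lemma borel_measurable_exceed_prob [measurable]: "exceed_prob K \<in> borel_measurable borel"
proof -
  have "(\<lambda>x. - exceed_prob K x) \<in> borel_measurable borel"
    by (rule borel_measurable_mono) (auto simp: mono_def exceed_prob_antimono)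
  from borel_measurable_uminus[OF this] show ?thesis
    by simp
qed

lemma measurable_case_nat_S [measurable]:
  "(\<lambda>(z, \<omega>). case_nat z \<omega>) \<in> measurable (\<mu> \<Otimes>\<^sub>M S) S"
  by measurable

text \<open>Stationarity: putting an independent increment in front of an i.i.d. sequence does not
  change its law.\<close>

lemma measure_S_iter:
  assumes [measurable]: "X \<in> sets S"
  shows "measure S X = measure (\<mu> \<Otimes>\<^sub>M S) {p. case_nat (fst p) (snd p) \<in> X}"
proof -
  have "measure S X = measure (distr (\<mu> \<Otimes>\<^sub>M S) S (\<lambda>(z, \<omega>). case_nat z \<omega>)) X"
    by (simp only: seq.PiM_iter)
  also have "\<dots> = measure (\<mu> \<Otimes>\<^sub>M S) {p. case_nat (fst p) (snd p) \<in> X}"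
    by (subst measure_distr)
       (auto intro!: arg_cong[where f = "measure (\<mu> \<Otimes>\<^sub>M S)"] simp: space_pair_measure split_beta)
  finally show ?thesis .
qed

lemma borel_measurable_psum_S [measurable]: "(\<lambda>\<omega>. psum \<omega> n) \<in> borel_measurable S"
  using borel_measurable_psum by (simp cong: measurable_cong_sets add: measurable_cong_sets[OF sets_S refl])

lemma borel_measurable_psup_S [measurable]: "psup \<in> borel_measurable S"
  using borel_measurable_psup by (simp add: measurable_cong_sets[OF sets_S refl])

lemma borel_measurable_peak_S [measurable]: "peak \<in> borel_measurable S"
  using borel_measurable_peak by (simp add: measurable_cong_sets[OF sets_S refl])

lemma sets_fresh: "{p. snd p \<in> exceed K (x - fst p) \<and> snd p \<notin> exceed K A} \<in> sets (\<mu> \<Otimes>\<^sub>M S)"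
proof -
  have "{p \<in> space (\<mu> \<Otimes>\<^sub>M S). (\<exists>k\<in>K. psum (snd p) k > x - fst p) \<and>
      \<not> (\<exists>k\<in>K. psum (snd p) k > A)} \<in> sets (\<mu> \<Otimes>\<^sub>M S)"
    by measurable
  thus ?thesis
    by (simp add: exceed_def space_pair_measure)
qed

text \<open>Conditioning on the first increment \<open>z\<close>; the two terms collect the cases where the
  remaining walk stays below \<open>A\<close> and where it exceeds \<open>A\<close>.\<close>

lemma exceed_prob_step:
  assumes "K' \<subseteq> insert 0 (Suc ` K)" "x \<ge> 0"
    and bound: "\<And>y. y \<ge> A \<Longrightarrow> exceed_prob K y \<le> C * tail F y"
  shows "exceed_prob K' x \<le> measure (\<mu> \<Otimes>\<^sub>M S) {p. snd p \<in> exceed K (x - fst p) \<and> snd p \<notin> exceed K A}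
           + C * conv_tail A x"
proof -
  interpret Q: pair_prob_space \<mu> S ..
  let ?Q = "\<mu> \<Otimes>\<^sub>M S"
  let ?U = "{p. snd p \<in> exceed K (x - fst p) \<and> snd p \<notin> exceed K A}"
  let ?V = "{p. snd p \<in> exceed K (max A (x - fst p))}"
  have V: "?V \<in> sets ?Q"
  proof -
    have "{p \<in> space ?Q. \<exists>k\<in>K. psum (snd p) k > max A (x - fst p)} \<in> sets ?Q"
      by measurable
    thus ?thesis
      by (simp add: exceed_def space_pair_measure)
  qed
  have "exceed_prob K' x = measure ?Q {p. case_nat (fst p) (snd p) \<in> exceed K' x}"
    unfolding exceed_prob_def by (intro measure_S_iter sets_exceed)
  also have "\<dots> \<le> measure ?Q (?U \<union> ?V)"
  proof (intro Q.finite_measure_mono subsetI)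
    fix p assume "p \<in> {p. case_nat (fst p) (snd p) \<in> exceed K' x}"
    then obtain k where k: "k \<in> K'" "psum (case_nat (fst p) (snd p)) k > x"
      by (auto simp: exceed_def)
    \<comment> \<open>The time 0 is impossible, because the empty sum is 0 and
      \<open>x \<ge> 0\<close>.\<close>
    with assms(1,2) obtain l where l: "l \<in> K" "k = Suc l"
      by (cases k) auto
    have less: "x - fst p < psum (snd p) l"
      using k(2) by (simp add: l(2))
    show "p \<in> ?U \<union> ?V"
    proof (cases "snd p \<in> exceed K A")
      case True
      then obtain m where m: "m \<in> K" "psum (snd p) m > A"
        by (auto simp: exceed_def)
      \<comment> \<open>The levels \<open>x - fst p\<close> and \<open>A\<close> may be passed at
        different times \<open>l\<close> and \<open>m\<close>; the witness is the time belonging to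
        the larger level.\<close>
      have "\<exists>k\<in>K. psum (snd p) k > max A (x - fst p)"
        using less l m by (cases "A \<le> x - fst p") (auto simp: max_def)
      thus ?thesis
        by (auto simp: exceed_def)
    qed (use less l in \<open>auto simp: exceed_def\<close>)
  qed (intro sets.Un sets_fresh V)
  also have "\<dots> \<le> measure ?Q ?U + measure ?Q ?V"
    by (intro measure_Un_le sets_fresh V)
  also have "measure ?Q ?V = (\<integral>z. measure S (Pair z -` ?V) \<partial>\<mu>)"
    by (intro measure_pair_eq_integral V mu.prob_space_axioms prob_space_S)
  also have "\<dots> = (\<integral>z. exceed_prob K (max A (x - z)) \<partial>\<mu>)"
    by (simp add: exceed_prob_def)
  also have "\<dots> \<le> (\<integral>z. C * tail F (max A (x - z)) \<partial>\<mu>)"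
  proof (rule integral_mono)
    show "integrable \<mu> (\<lambda>z. exceed_prob K (max A (x - z)))"
      by (rule mu.integrable_const_bound[where B = 1]) (auto simp: exceed_prob_nonneg exceed_prob_le_1)
    show "integrable \<mu> (\<lambda>z. C * tail F (max A (x - z)))"
      by (intro integrable_mult_right mu.integrable_const_bound[where B = 1])
         (auto simp: tail_le_1 less_imp_le[OF tail_pos])
  qed (auto intro: bound)
  finally show ?thesis
    by (simp add: conv_tail_def)
qed

text \<open>If the remaining walk stays below \<open>A\<close>, the first increment alone must
  exceed \<open>x - A\<close>. The bound is crude but uniform in \<open>K\<close>, as the induction
  over finite maxima requires.\<close>

lemma fresh_le_tail:
  "measure (\<mu> \<Otimes>\<^sub>M S) {p. snd p \<in> exceed K (x - fst p) \<and> snd p \<notin> exceed K A} \<le> tail F (x - A)"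
  (is "measure _ ?U \<le> _")
proof -
  interpret Q: pair_prob_space \<mu> S ..
  have X: "{x - A<..} \<times> UNIV \<in> sets (\<mu> \<Otimes>\<^sub>M S)"
    using sets.top[of S] by (intro pair_measureI) auto
  have "measure (\<mu> \<Otimes>\<^sub>M S) ?U \<le> measure (\<mu> \<Otimes>\<^sub>M S) ({x - A<..} \<times> UNIV)"
  proof (rule Q.finite_measure_mono)
    show "{x - A<..} \<times> UNIV \<in> sets (\<mu> \<Otimes>\<^sub>M S)"
      by (rule X)
    show "?U \<subseteq> {x - A<..} \<times> UNIV"
      by (force simp: exceed_def not_less)
  qed
  also have "\<dots> = (\<integral>\<omega>. measure \<mu> ((\<lambda>z. (z, \<omega>)) -` ({x - A<..} \<times> UNIV)) \<partial>S)"
    by (intro measure_pair_eq_integral X mu.prob_space_axioms prob_space_S)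
  also have "\<dots> = tail F (x - A)"
    using seq.P.prob_space by (simp add: vimage_def lessThan_def greaterThan_def[symmetric] measure_\<mu>_greaterThan)
  finally show ?thesis .
qed

text \<open>For the global supremum M the event is exact: on M \<le> A the first increment has to
  exceed x - M, and integrating it out leaves the tail of \<open>F\<close>.\<close>

lemma fresh_eq_integral:
  "measure (\<mu> \<Otimes>\<^sub>M S) {p. snd p \<in> exceed UNIV (x - fst p) \<and> snd p \<notin> exceed UNIV A}
     = (\<integral>\<omega>. indicator {\<omega>. psup \<omega> \<le> ereal A} \<omega> * tail F (x - peak \<omega>) \<partial>S)"
  (is "measure _ ?U = _")
proof -
  have "measure (\<mu> \<Otimes>\<^sub>M S) ?U = (\<integral>\<omega>. measure \<mu> ((\<lambda>z. (z, \<omega>)) -` ?U) \<partial>S)"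
    by (intro measure_pair_eq_integral sets_fresh mu.prob_space_axioms prob_space_S)
  also have "\<dots> = (\<integral>\<omega>. indicator {\<omega>. psup \<omega> \<le> ereal A} \<omega> * tail F (x - peak \<omega>) \<partial>S)"
  proof (intro Bochner_Integration.integral_cong refl)
    fix \<omega>
    have "(\<lambda>z. (z, \<omega>)) -` ?U = (if psup \<omega> \<le> ereal A then {x - peak \<omega><..} else {})"
    proof (cases "psup \<omega> \<le> ereal A")
      case True
      hence "psup \<omega> = ereal (peak \<omega>)"
        by (intro psup_eq_peak) auto
      hence "(\<exists>k. psum \<omega> k > x - z) \<longleftrightarrow> z > x - peak \<omega>" for z
        using less_psup_iff[of "x - z" \<omega>] by auto
      with True show ?thesis
        by (auto simp: exceed_def psup_le_iff not_less)
    qed (auto simp: exceed_def psup_le_iff not_less)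
    thus "measure \<mu> ((\<lambda>z. (z, \<omega>)) -` ?U) =
        indicator {\<omega>. psup \<omega> \<le> ereal A} \<omega> * tail F (x - peak \<omega>)"
      by (simp add: measure_\<mu>_greaterThan)
  qed
  finally show ?thesis .
qed

section \<open>A linear bound by the tail, uniform in the time horizon\<close>

text \<open>The recursion needs a bound to start from, which is available at horizon 0 but not yet
  for the supremum. One step turns the constant \<open>C\<close> into
  \<open>B + C * \<theta>\<close> with \<open>\<theta> < 1\<close>, so the fixed point of this map
  survives every induction step.\<close>

lemma exceed_prob_finite_le_tail: "\<exists>C\<ge>0. \<forall>n x. exceed_prob {..n} x \<le> C * tail F x"
proof -
  define \<theta> where "\<theta> = (1 + \<phi>) / 2"
  have \<theta>: "\<phi> < \<theta>" "\<theta> < 1"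
    using \<phi>_less_1 by (auto simp: \<theta>_def)
  have "((\<lambda>A. 2 * \<phi> - \<phi>_upto A) \<longlongrightarrow> 2 * \<phi> - \<phi>) at_top"
    by (intro tendsto_intros \<phi>_upto_tendsto)
  hence "\<forall>\<^sub>F A in at_top. 2 * \<phi> - \<phi>_upto A < \<theta>"
    using \<theta> by (intro order_tendstoD(2)) auto
  then obtain A where A: "2 * \<phi> - \<phi>_upto A < \<theta>"
    using eventually_happens[of _ "at_top :: real filter"] by auto
  have "\<forall>\<^sub>F x in at_top. conv_tail A x / tail F x < \<theta> \<and> tail F (x - A) / tail F x < exp (\<gamma> * A) + 1"
    using A by (intro eventually_conj order_tendstoD(2)[OF conv_tail_tendsto]
        order_tendstoD(2)[OF tail_shift]) auto
  then obtain x1 where "\<And>x. x \<ge> x1 \<Longrightarrow>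
      conv_tail A x / tail F x < \<theta> \<and> tail F (x - A) / tail F x < exp (\<gamma> * A) + 1"
    by (auto simp: eventually_at_top_linorder)
  hence x1: "conv_tail A x \<le> \<theta> * tail F x" "tail F (x - A) \<le> (exp (\<gamma> * A) + 1) * tail F x" if "x \<ge> x1" for x
    using that tail_pos[of x] by (meson less_imp_le pos_divide_less_eq)+
  \<comment> \<open>The 0 meets the hypothesis \<open>x \<ge> 0\<close> of the recursion. The first
    entry of \<open>B\<close> makes the claim trivial for \<open>x \<le> x0\<close>, the second
    absorbs \<open>tail F (x - A)\<close>, and \<open>C\<close> solves
    \<open>C = B + C * \<theta>\<close>.\<close>
  define x0 where "x0 = max 0 x1"
  define B where "B = max (1 / tail F x0) (exp (\<gamma> * A) + 1)"
  define C where "C = B / (1 - \<theta>)"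
  have "B > 0"
    by (simp add: B_def less_max_iff_disj add_pos_pos)
  have C: "C \<ge> B" "C = B + C * \<theta>"
    using \<theta> \<phi>_nonneg \<open>B > 0\<close> by (auto simp: C_def field_simps)
  have small: "1 \<le> C * tail F x" if "x \<le> x0" for x
  proof -
    have "1 = (1 / tail F x0) * tail F x0"
      using tail_pos[of x0] by simp
    also have "\<dots> \<le> C * tail F x"
      using tail_pos[of x0] C \<open>B > 0\<close>
      by (intro mult_mono tail_antimono that) (auto simp: B_def)
    finally show ?thesis .
  qed
  have "exceed_prob {..n} x \<le> C * tail F x" for n x
  proof (induction n arbitrary: x)
    case 0
    have "exceed_prob {..0} x = 0" if "x \<ge> 0"
    proof -
      have "exceed {..0} x = {}"
        using that by (auto simp: exceed_def)
      thus ?thesis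
        by (simp add: exceed_prob_def)
    qed
    moreover have "exceed_prob {..0} x \<le> C * tail F x" if "x < 0"
      by (rule order_trans[OF exceed_prob_le_1 small]) (use that in \<open>simp add: x0_def le_max_iff_disj\<close>)
    ultimately show ?case
      using C \<open>B > 0\<close> tail_pos[of x] by (cases "x < 0") auto
  next
    case (Suc n)
    show ?case
    proof (cases "x \<ge> x0")
      case True
      have "exceed_prob {..Suc n} x \<le> tail F (x - A) + C * conv_tail A x"
        using True Suc
        by (intro order_trans[OF exceed_prob_step[of "{..Suc n}" "{..n}" x A C]] add_right_mono fresh_le_tail)
           (auto simp: x0_def atMost_Suc_eq_insert_0)
      also have "\<dots> \<le> B * tail F x + C * (\<theta> * tail F x)"
      proof (intro add_mono mult_left_mono x1)
        have "tail F (x - A) \<le> (exp (\<gamma> * A) + 1) * tail F x"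
          using True by (intro x1) (simp add: x0_def)
        also have "\<dots> \<le> B * tail F x"
          using tail_pos[of x] by (intro mult_right_mono) (auto simp: B_def)
        finally show "tail F (x - A) \<le> B * tail F x" .
      qed (use C \<open>B > 0\<close> True in \<open>auto simp: x0_def\<close>)
      also have "\<dots> = (B + C * \<theta>) * tail F x"
        by (simp add: algebra_simps)
      finally show ?thesis
        using C(2) by simp
    qed (use small[of x] exceed_prob_le_1[of "{..Suc n}" x] in auto)
  qed
  moreover have "C \<ge> 0"
    using C \<open>B > 0\<close> by simp
  ultimately show ?thesis
    by blast
qed

text \<open>Continuity from below in \<open>n\<close>, since the constant does not depend on the
  horizon.\<close>

lemma exceed_prob_UNIV_le_tail: "\<exists>C\<ge>0. \<forall>x. exceed_prob UNIV x \<le> C * tail F x"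
proof -
  obtain C where C: "C \<ge> 0" "\<And>n x. exceed_prob {..n} x \<le> C * tail F x"
    using exceed_prob_finite_le_tail by blast
  have "exceed_prob UNIV x \<le> C * tail F x" for x
  proof (rule LIMSEQ_le_const2)
    have "(\<lambda>n. measure S (exceed {..n} x)) \<longlonglongrightarrow> measure S (\<Union>n. exceed {..n} x)"
      using sets_exceed
      by (intro seq.P.finite_Lim_measure_incseq) (auto simp: incseq_def, auto simp: exceed_def)
    also have "(\<Union>n. exceed {..n} x) = exceed UNIV x"
      by (auto simp: exceed_def)
    finally show "(\<lambda>n. exceed_prob {..n} x) \<longlonglongrightarrow> exceed_prob UNIV x"
      by (simp add: exceed_prob_def)
  qed (use C in auto)
  with C show ?thesis
    by blast
qed

section \<open>Exponential moments of the partial sums and of the supremum\<close>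

lemma exp_psum:
  shows nn_integral_exp_psum: "(\<integral>\<^sup>+\<omega>. ennreal (exp (\<gamma> * psum \<omega> n)) \<partial>S) = ennreal (\<phi> ^ n)"
    and integrable_exp_psum: "integrable S (\<lambda>\<omega>. exp (\<gamma> * psum \<omega> n))"
    and integral_exp_psum: "(\<integral>\<omega>. exp (\<gamma> * psum \<omega> n) \<partial>S) = \<phi> ^ n"
proof -
  show *: "(\<integral>\<^sup>+\<omega>. ennreal (exp (\<gamma> * psum \<omega> n)) \<partial>S) = ennreal (\<phi> ^ n)"
  proof (induction n)
    case 0
    show ?case
      using seq.P.emeasure_space_1 by simp
  next
    case (Suc n)
    interpret Q: pair_prob_space \<mu> S ..
    have "(\<integral>\<^sup>+\<omega>. ennreal (exp (\<gamma> * psum \<omega> (Suc n))) \<partial>S)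
        = (\<integral>\<^sup>+\<omega>. ennreal (exp (\<gamma> * psum \<omega> (Suc n))) \<partial>distr (\<mu> \<Otimes>\<^sub>M S) S (\<lambda>(z, \<omega>). case_nat z \<omega>))"
      by (simp only: seq.PiM_iter)
    also have "\<dots> = (\<integral>\<^sup>+p. ennreal (exp (\<gamma> * fst p) * exp (\<gamma> * psum (snd p) n)) \<partial>(\<mu> \<Otimes>\<^sub>M S))"
      by (subst nn_integral_distr) (auto simp: split_beta distrib_left exp_add)
    also have "\<dots> = (\<integral>\<^sup>+z. \<integral>\<^sup>+\<omega>. ennreal (exp (\<gamma> * z)) * ennreal (exp (\<gamma> * psum \<omega> n)) \<partial>S \<partial>\<mu>)"
      by (subst seq.P.nn_integral_fst[symmetric]) (auto simp: ennreal_mult)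
    also have "\<dots> = (\<integral>\<^sup>+z. ennreal (exp (\<gamma> * z)) \<partial>\<mu>) * ennreal (\<phi> ^ n)"
      by (simp add: nn_integral_cmult nn_integral_multc Suc)
    also have "(\<integral>\<^sup>+z. ennreal (exp (\<gamma> * z)) \<partial>\<mu>) = ennreal \<phi>"
      using mgf_eq by (simp add: mgf_def)
    finally show ?case
      using \<phi>_nonneg by (simp add: ennreal_mult)
  qed
  show "integrable S (\<lambda>\<omega>. exp (\<gamma> * psum \<omega> n))" "(\<integral>\<omega>. exp (\<gamma> * psum \<omega> n) \<partial>S) = \<phi> ^ n"
    using * \<phi>_nonneg by (auto simp: nn_integral_eq_integrable)
qed

text \<open>This is E exp(\<gamma> M); \<open>nn_integral_exp_psup\<close> confirms that it agrees
  with the extended-real version.\<close>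

definition peak_mgf :: real where "peak_mgf = (\<integral>\<omega>. exp (\<gamma> * peak \<omega>) \<partial>S)"

lemma borel_measurable_exp_ereal [measurable]: "exp_ereal \<in> borel_measurable borel"
proof -
  have "exp_ereal = (\<lambda>x. if x = \<infinity> then \<infinity> else if x = -\<infinity> then 0 else ennreal (exp (real_of_ereal x)))"
    by (auto simp: exp_ereal_def fun_eq_iff split: ereal.split)
  also have "\<dots> \<in> borel_measurable borel"
    by measurable
  finally show ?thesis .
qed

text \<open>The variable exp(\<gamma> M) is at most the sum of exp(\<gamma> S_n) over all n, whose
  expectation is a geometric series in \<open>\<phi>\<close>. Finiteness of this expectation also
  yields that M is almost surely finite, without a law of large numbers.\<close>

lemma exp_peak:
  shows AE_psup_finite: "AE \<omega> in S. psup \<omega> = ereal (peak \<omega>)"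
    and integrable_exp_peak: "integrable S (\<lambda>\<omega>. exp (\<gamma> * peak \<omega>))"
    and nn_integral_exp_psup: "(\<integral>\<^sup>+\<omega>. exp_ereal (ereal \<gamma> * psup \<omega>) \<partial>S) = ennreal peak_mgf"
    and peak_mgf_ge_1: "1 \<le> peak_mgf"
proof -
  let ?I = "\<integral>\<^sup>+\<omega>. exp_ereal (ereal \<gamma> * psup \<omega>) \<partial>S"
  have "?I \<le> (\<integral>\<^sup>+\<omega>. (\<Sum>n. ennreal (exp (\<gamma> * psum \<omega> n))) \<partial>S)"
  proof (intro nn_integral_mono exp_ereal_psup_le \<gamma>_pos)
    fix \<omega> n
    have "(\<Sum>i\<in>{n}. ennreal (exp (\<gamma> * psum \<omega> i))) \<le> (\<Sum>i. ennreal (exp (\<gamma> * psum \<omega> i)))"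
      by (rule sum_le_suminf) auto
    thus "ennreal (exp (\<gamma> * psum \<omega> n)) \<le> (\<Sum>i. ennreal (exp (\<gamma> * psum \<omega> i)))"
      by simp
  qed
  also have "\<dots> = (\<Sum>n. ennreal (\<phi> ^ n))"
    by (subst nn_integral_suminf) (auto simp: nn_integral_exp_psum)
  also have "\<dots> = ennreal (1 / (1 - \<phi>))"
    using \<phi>_nonneg \<phi>_less_1 by (intro suminf_ennreal_eq geometric_sums) auto
  finally have fin: "?I < \<infinity>"
    by (rule le_less_trans) simp
  have "AE \<omega> in S. exp_ereal (ereal \<gamma> * psup \<omega>) \<noteq> \<infinity>"
    using fin by (intro nn_integral_PInf_AE) auto
  thus AE: "AE \<omega> in S. psup \<omega> = ereal (peak \<omega>)"
  proof eventually_elim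
    case (elim \<omega>)
    thus ?case
      using \<gamma>_pos by (intro psup_eq_peak) (auto simp: exp_ereal_def)
  qed
  have eq: "?I = (\<integral>\<^sup>+\<omega>. ennreal (exp (\<gamma> * peak \<omega>)) \<partial>S)"
    using AE by (intro nn_integral_cong_AE) (auto elim!: eventually_mono simp: exp_ereal_def)
  thus int: "integrable S (\<lambda>\<omega>. exp (\<gamma> * peak \<omega>))"
    using fin by (intro integrableI_nonneg) auto
  show "?I = ennreal peak_mgf"
    unfolding eq peak_mgf_def using int by (intro nn_integral_eq_integral) auto
  have "(\<integral>\<omega>. 1 \<partial>S) \<le> peak_mgf"
    unfolding peak_mgf_def
  proof (intro integral_mono_AE int)
    show "AE \<omega> in S. 1 \<le> exp (\<gamma> * peak \<omega>)"
      using AE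
    proof eventually_elim
      case (elim \<omega>)
      thus ?case
        using psup_nonneg[of \<omega>] \<gamma>_pos by simp
    qed
  qed auto
  thus "1 \<le> peak_mgf"
    using seq.P.prob_space by simp
qed

lemma sets_psup_le [measurable]: "{\<omega>. psup \<omega> \<le> ereal A} \<in> sets S"
proof -
  have "{\<omega> \<in> space S. psup \<omega> \<le> ereal A} \<in> sets S"
    by measurable
  thus ?thesis
    by simp
qed

lemma peak_le: "psup \<omega> \<le> ereal A \<Longrightarrow> peak \<omega> \<le> A"
  using psup_eq_peak[of \<omega>] by force

lemma peak_mgf_upto_tendsto:
  "((\<lambda>A. \<integral>\<omega>. indicator {\<omega>. psup \<omega> \<le> ereal A} \<omega> * exp (\<gamma> * peak \<omega>) \<partial>S) \<longlongrightarrow> peak_mgf) at_top"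
  unfolding peak_mgf_def
proof (intro tendsto_integral_exhaustion_at_top integrable_exp_peak sets_psup_le)
  show "AE \<omega> in S. \<forall>\<^sub>F A in at_top. \<omega> \<in> {\<omega>. psup \<omega> \<le> ereal A}"
    using AE_psup_finite by eventually_elim (simp add: eventually_ge_at_top)
qed

section \<open>The upper bound for the supremum\<close>

text \<open>One pass through the recursion. \<open>A\<close> is fixed first, large enough for the
  truncated moments to be near their limits and for the bound \<open>c\<close> to hold from
  \<open>A\<close> on; only then does \<open>x\<close> tend to infinity.\<close>

lemma exceed_prob_improve:
  assumes c: "c \<ge> 0" and ev: "\<forall>\<^sub>F x in at_top. exceed_prob UNIV x \<le> c * tail F x" and "\<delta> > 0"
  shows "\<forall>\<^sub>F x in at_top. exceed_prob UNIV x \<le> (peak_mgf + c * \<phi> + \<delta>) * tail F x"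
proof -
  let ?e = "\<lambda>A. \<integral>\<omega>. indicator {\<omega>. psup \<omega> \<le> ereal A} \<omega> * exp (\<gamma> * peak \<omega>) \<partial>S"
  let ?f = "\<lambda>A x. \<integral>\<omega>. indicator {\<omega>. psup \<omega> \<le> ereal A} \<omega> * tail F (x - peak \<omega>) \<partial>S"
  have "((\<lambda>A. ?e A + c * (2 * \<phi> - \<phi>_upto A)) \<longlongrightarrow> peak_mgf + c * (2 * \<phi> - \<phi>)) at_top"
    by (intro tendsto_intros peak_mgf_upto_tendsto \<phi>_upto_tendsto)
  hence "\<forall>\<^sub>F A in at_top. ?e A + c * (2 * \<phi> - \<phi>_upto A) < peak_mgf + c * \<phi> + \<delta>"
    using \<open>\<delta> > 0\<close> by (intro order_tendstoD(2)) auto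
  moreover have "\<forall>\<^sub>F A in at_top. \<forall>y\<ge>A. exceed_prob UNIV y \<le> c * tail F y"
    using ev by (simp add: eventually_all_ge_at_top)
  ultimately have "\<forall>\<^sub>F A in at_top. ?e A + c * (2 * \<phi> - \<phi>_upto A) < peak_mgf + c * \<phi> + \<delta> \<and>
      (\<forall>y\<ge>A. exceed_prob UNIV y \<le> c * tail F y)"
    by (rule eventually_conj)
  then obtain A where
    A: "?e A + c * (2 * \<phi> - \<phi>_upto A) < peak_mgf + c * \<phi> + \<delta>" "\<And>y. y \<ge> A \<Longrightarrow> exceed_prob UNIV y \<le> c * tail F y"
    using eventually_happens[of _ "at_top :: real filter"] by auto
  have "((\<lambda>x. ?f A x / tail F x + c * (conv_tail A x / tail F x)) \<longlongrightarrow> ?e A + c * (2 * \<phi> - \<phi>_upto A)) at_top"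
    by (intro tendsto_add tendsto_mult_left conv_tail_tendsto tail_shift_integral[where A = A]
          seq.P.finite_measure_axioms sets_psup_le borel_measurable_peak_S) (simp add: peak_le)
  from order_tendstoD(2)[OF this A(1)] eventually_ge_at_top[of 0] show ?thesis
  proof eventually_elim
    case (elim x)
    have "exceed_prob UNIV x \<le> ?f A x + c * conv_tail A x"
      unfolding fresh_eq_integral[symmetric] using A(2) elim(2)
      by (intro exceed_prob_step) (auto simp: UNIV_nat_eq[symmetric])
    also have "\<dots> = (?f A x / tail F x + c * (conv_tail A x / tail F x)) * tail F x"
      using tail_pos[of x] by (simp add: field_simps)
    also have "\<dots> \<le> (peak_mgf + c * \<phi> + \<delta>) * tail F x"
      using elim tail_pos[of x] by (intro mult_right_mono) auto
    finally show ?case .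
  qed
qed

text \<open>Instead of iterating the improvement, it is applied to constants near the infimum of all
  asymptotic constants; that infimum then satisfies the fixed-point inequality.\<close>

lemma exceed_prob_UNIV_upper:
  assumes "d > peak_mgf / (1 - \<phi>)"
  shows "\<forall>\<^sub>F x in at_top. exceed_prob UNIV x / tail F x < d"
proof -
  define Cs where "Cs = {c. c \<ge> 0 \<and> (\<forall>\<^sub>F x in at_top. exceed_prob UNIV x \<le> c * tail F x)}"
  have ne: "Cs \<noteq> {}"
    using exceed_prob_UNIV_le_tail by (auto simp: Cs_def)
  have bdd: "bdd_below Cs"
    by (auto simp: Cs_def intro!: bdd_belowI[of _ 0])
  \<comment> \<open>Half of \<open>\<eta>\<close> pays for the infimum possibly not being attained,
    the other half for the error in the improvement.\<close>
  have "Inf Cs * (1 - \<phi>) \<le> peak_mgf + \<eta>" if \<eta>: "\<eta> > 0" for \<eta>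
  proof -
    obtain c where c: "c \<in> Cs" "c < Inf Cs + \<eta> / 2"
      using cInf_lessD[OF ne, of "Inf Cs + \<eta> / 2"] \<eta> by auto
    have "peak_mgf + c * \<phi> + \<eta> / 2 \<in> Cs"
      using exceed_prob_improve[of c "\<eta> / 2"] c(1) \<eta> peak_mgf_ge_1 \<phi>_nonneg by (auto simp: Cs_def)
    hence "Inf Cs \<le> peak_mgf + c * \<phi> + \<eta> / 2"
      by (rule cInf_lower[OF _ bdd])
    also have "c * \<phi> \<le> (Inf Cs + \<eta> / 2) * \<phi>"
      using c \<phi>_nonneg by (intro mult_right_mono) auto
    also have "\<dots> \<le> Inf Cs * \<phi> + \<eta> / 2"
      using mult_left_mono[of \<phi> 1 "\<eta> / 2"] \<phi>_less_1 \<eta> by (simp add: algebra_simps)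
    finally show ?thesis
      by (simp add: algebra_simps)
  qed
  hence "Inf Cs * (1 - \<phi>) \<le> peak_mgf"
    by (rule field_le_epsilon)
  hence "Inf Cs < d"
    using assms \<phi>_less_1 by (meson diff_gt_0_iff_gt le_less_trans pos_le_divide_eq)
  then obtain c where c: "c \<in> Cs" "c < d"
    using cInf_lessD[OF ne] by blast
  hence "\<forall>\<^sub>F x in at_top. exceed_prob UNIV x \<le> c * tail F x"
    by (simp add: Cs_def)
  thus ?thesis
  proof eventually_elim
    case (elim x)
    hence "exceed_prob UNIV x / tail F x \<le> c"
      using tail_pos[of x] by (simp add: pos_divide_le_eq)
    with c show ?case
      by simp
  qed
qed

section \<open>The lower bound from a single big jump\<close>

text \<open>The intersection of M > x with the crossing event of index n = j + 1, so
  \<open>j\<close> counts the steps before the jump.\<close>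

definition overshoot :: "nat \<Rightarrow> real \<Rightarrow> real \<Rightarrow> (nat \<Rightarrow> real) set" where
  "overshoot j a x = {\<omega>. (\<forall>k\<le>j. psum \<omega> k \<le> a) \<and> psum \<omega> (Suc j) > x - a \<and> (\<exists>k. psum \<omega> k > x)}"

definition low :: "nat \<Rightarrow> real \<Rightarrow> (nat \<Rightarrow> real) set" where
  "low j a = {\<omega>. \<forall>k\<le>j. psum \<omega> k \<le> a}"

text \<open>The asymptotic weight of a jump at step j + 1: one factor for the walk before the jump,
  one for the independent walk after it.\<close>

definition low_mass :: "nat \<Rightarrow> real \<Rightarrow> real" where
  "low_mass j a = (\<integral>\<omega>. indicator (low j a) \<omega> * exp (\<gamma> * psum \<omega> j) \<partial>S) *
     (\<integral>\<omega>. indicator {\<omega>. psup \<omega> \<le> ereal a} \<omega> * exp (\<gamma> * peak \<omega>) \<partial>S)"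

lemma sets_overshoot [measurable]: "overshoot j a x \<in> sets S"
proof -
  have "{\<omega> \<in> space S. (\<forall>k\<le>j. psum \<omega> k \<le> a) \<and> psum \<omega> (Suc j) > x - a \<and> (\<exists>k. psum \<omega> k > x)} \<in> sets S"
    by measurable
  thus ?thesis
    by (simp add: overshoot_def)
qed

lemma sets_low [measurable]: "low j a \<in> sets S"
proof -
  have "{\<omega> \<in> space S. \<forall>k\<le>j. psum \<omega> k \<le> a} \<in> sets S"
    by measurable
  thus ?thesis
    by (simp add: low_def)
qed

lemma low_mass_tendsto: "((low_mass j) \<longlongrightarrow> \<phi> ^ j * peak_mgf) at_top"
proof -
  have "((\<lambda>a. \<integral>\<omega>. indicator (low j a) \<omega> * exp (\<gamma> * psum \<omega> j) \<partial>S) \<longlongrightarrow> \<phi> ^ j) at_top"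
    unfolding integral_exp_psum[symmetric]
  proof (intro tendsto_integral_exhaustion_at_top integrable_exp_psum sets_low AE_I2)
    fix \<omega>
    have "\<forall>\<^sub>F a in at_top. \<forall>k\<in>{..j}. psum \<omega> k \<le> a"
      by (intro eventually_ball_finite) (auto simp: eventually_ge_at_top)
    thus "\<forall>\<^sub>F a in at_top. \<omega> \<in> low j a"
      by eventually_elim (simp add: low_def)
  qed
  thus ?thesis
    unfolding low_mass_def[abs_def] by (intro tendsto_mult peak_mgf_upto_tendsto)
qed

text \<open>Split the walk into its first \<open>j\<close> increments, the big jump, and the walk after the jump;
  integrating out the jump leaves the tail of \<open>F\<close>.\<close>

lemma measure_overshoot_ge:
  "(\<integral>p. indicator (low j a \<times> {\<omega>. psup \<omega> \<le> ereal a}) p *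
       tail F (x - (psum (fst p) j + peak (snd p))) \<partial>(S \<Otimes>\<^sub>M S)) \<le> measure S (overshoot j a x)"
  (is "(\<integral>p. ?f p \<partial>_) \<le> measure S ?X")
proof -
  interpret SS: pair_prob_space S S ..
  interpret mS: pair_prob_space \<mu> S ..
  have X [measurable]: "?X \<in> sets S"
    by (rule sets_overshoot)
  have E [measurable]: "low j a \<times> {\<omega>. psup \<omega> \<le> ereal a} \<in> sets (S \<Otimes>\<^sub>M S)"
    by (intro pair_measureI sets_low sets_psup_le)
  have f [measurable]: "?f \<in> borel_measurable (S \<Otimes>\<^sub>M S)"
    by measurable
  have f_nonneg: "0 \<le> ?f p" and f_le: "?f p \<le> 1" for p
    using tail_le_1 tail_pos by (auto simp: indicator_def less_imp_le)
  have "ennreal (\<integral>p. ?f p \<partial>(S \<Otimes>\<^sub>M S)) = (\<integral>\<^sup>+p. ennreal (?f p) \<partial>(S \<Otimes>\<^sub>M S))"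
    using f_nonneg f_le
    by (intro nn_integral_eq_integral[symmetric] SS.integrable_const_bound[where B = 1]) auto
  also have "\<dots> = (\<integral>\<^sup>+\<omega>. \<integral>\<^sup>+\<omega>'. ennreal (?f (\<omega>, \<omega>')) \<partial>S \<partial>S)"
    by (intro seq.P.nn_integral_fst[symmetric]) measurable
  \<comment> \<open>The spliced sequence takes \<open>j\<close> increments from
    \<open>\<omega>\<close>, then the jump \<open>z\<close>, then all of \<open>\<omega>'\<close>.
    Only an inequality holds, since \<open>overshoot\<close> also allows a gain above
    \<open>a\<close> after the jump.\<close>
  also have "\<dots> \<le> (\<integral>\<^sup>+\<omega>. \<integral>\<^sup>+\<omega>'. emeasure \<mu> {z. comb_seq j \<omega> (case_nat z \<omega>') \<in> ?X} \<partial>S \<partial>S)"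
  proof (intro nn_integral_mono)
    fix \<omega> \<omega>' assume "\<omega> \<in> space S" "\<omega>' \<in> space S"
    have [measurable]: "{z. comb_seq j \<omega> (case_nat z \<omega>') \<in> ?X} \<in> sets \<mu>"
    proof -
      have "{z \<in> space \<mu>. comb_seq j \<omega> (case_nat z \<omega>') \<in> ?X} \<in> sets \<mu>"
        using \<open>\<omega> \<in> space S\<close> \<open>\<omega>' \<in> space S\<close> by measurable
      thus ?thesis
        by simp
    qed
    show "ennreal (?f (\<omega>, \<omega>')) \<le> emeasure \<mu> {z. comb_seq j \<omega> (case_nat z \<omega>') \<in> ?X}"
    proof (cases "\<omega> \<in> low j a \<and> psup \<omega>' \<le> ereal a")
      case True
      hence low: "psum \<omega> k \<le> a" if "k \<le> j" for k
        using that by (simp add: low_def)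
      have eq: "psup \<omega>' = ereal (peak \<omega>')"
        using True by (intro psup_eq_peak) auto
      have le: "peak \<omega>' \<le> a"
        using True by (intro peak_le) auto
      \<comment> \<open>Such a jump lets some later sum exceed \<open>x\<close>; because at most
        \<open>a\<close> is gained afterwards, the jump itself must already land above
        \<open>x - a\<close>.\<close>
      have "{x - (psum \<omega> j + peak \<omega>')<..} \<subseteq> {z. comb_seq j \<omega> (case_nat z \<omega>') \<in> ?X}"
      proof (intro subsetI CollectI)
        fix z assume "z \<in> {x - (psum \<omega> j + peak \<omega>')<..}"
        hence z: "x - psum \<omega> j - z < peak \<omega>'"
          by simp
        hence "ereal (x - psum \<omega> j - z) < psup \<omega>'"
          using eq by simp
        then obtain k where "psum \<omega>' k > x - psum \<omega> j - z"
          by (auto simp: less_psup_iff)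
        hence "psum (comb_seq j \<omega> (case_nat z \<omega>')) (j + Suc k) > x"
          unfolding psum_comb_seq_add psum_case_nat by simp
        moreover have "psum (comb_seq j \<omega> (case_nat z \<omega>')) (Suc j) > x - a"
          using psum_comb_seq_add[of j \<omega> "case_nat z \<omega>'" "Suc 0"] z le by simp
        ultimately show "comb_seq j \<omega> (case_nat z \<omega>') \<in> ?X"
          using low by (auto simp: overshoot_def psum_comb_seq_le)
      qed
      hence "emeasure \<mu> {x - (psum \<omega> j + peak \<omega>')<..} \<le> emeasure \<mu> {z. comb_seq j \<omega> (case_nat z \<omega>') \<in> ?X}"
        by (intro emeasure_mono) measurable
      thus ?thesis
        using True by (simp add: mu.emeasure_eq_measure measure_\<mu>_greaterThan)
    qed auto
  qed
  \<comment> \<open>The pieces are glued together again: first the jump with the walk after it, then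
    the result with the first \<open>j\<close> increments.\<close>
  also have "\<dots> = (\<integral>\<^sup>+\<omega>. emeasure S {\<omega>'. comb_seq j \<omega> \<omega>' \<in> ?X} \<partial>S)"
  proof (intro nn_integral_cong)
    fix \<omega> assume \<omega>: "\<omega> \<in> space S"
    have Y: "{\<omega>'. comb_seq j \<omega> \<omega>' \<in> ?X} \<in> sets S" (is "?Y \<in> _")
    proof -
      have "{\<omega>' \<in> space S. comb_seq j \<omega> \<omega>' \<in> ?X} \<in> sets S"
        using \<omega> by measurable
      thus ?thesis
        by simp
    qed
    note [measurable] = Y
    have "emeasure S ?Y = emeasure (distr (\<mu> \<Otimes>\<^sub>M S) S (\<lambda>(z, \<omega>). case_nat z \<omega>)) ?Y"
      by (simp only: seq.PiM_iter)
    also have "\<dots> = emeasure (\<mu> \<Otimes>\<^sub>M S) ((\<lambda>(z, \<omega>). case_nat z \<omega>) -` ?Y \<inter> space (\<mu> \<Otimes>\<^sub>M S))"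
      by (intro emeasure_distr) auto
    also have "\<dots> = (\<integral>\<^sup>+\<omega>'. emeasure \<mu> ((\<lambda>z. (z, \<omega>')) -` ((\<lambda>(z, \<omega>). case_nat z \<omega>) -` ?Y \<inter> space (\<mu> \<Otimes>\<^sub>M S))) \<partial>S)"
      by (intro mS.emeasure_pair_measure_alt2 measurable_sets[OF measurable_case_nat_S Y])
    also have "\<dots> = (\<integral>\<^sup>+\<omega>'. emeasure \<mu> {z. comb_seq j \<omega> (case_nat z \<omega>') \<in> ?X} \<partial>S)"
      by (intro nn_integral_cong arg_cong[where f = "emeasure \<mu>"]) (auto simp: space_pair_measure)
    finally show "(\<integral>\<^sup>+\<omega>'. emeasure \<mu> {z. comb_seq j \<omega> (case_nat z \<omega>') \<in> ?X} \<partial>S) = emeasure S ?Y" ..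
  qed
  also have "\<dots> = (\<integral>\<^sup>+\<omega>. emeasure S (Pair \<omega> -` ((\<lambda>(\<omega>, \<omega>'). comb_seq j \<omega> \<omega>') -` ?X \<inter> space (S \<Otimes>\<^sub>M S))) \<partial>S)"
    by (intro nn_integral_cong arg_cong[where f = "emeasure S"]) (auto simp: space_pair_measure)
  also have "\<dots> = emeasure (S \<Otimes>\<^sub>M S) ((\<lambda>(\<omega>, \<omega>'). comb_seq j \<omega> \<omega>') -` ?X \<inter> space (S \<Otimes>\<^sub>M S))"
    by (intro seq.P.emeasure_pair_measure_alt[symmetric] measurable_sets[OF measurable_comb_seq X])
  also have "\<dots> = emeasure (distr (S \<Otimes>\<^sub>M S) S (\<lambda>(\<omega>, \<omega>'). comb_seq j \<omega> \<omega>')) ?X"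
    by (intro emeasure_distr[symmetric] measurable_comb_seq X)
  also have "\<dots> = ennreal (measure S ?X)"
    by (simp only: seq.PiM_comb_seq seq.P.emeasure_eq_measure)
  finally show ?thesis
    by simp
qed

text \<open>Both truncations together bound the shift by \<open>2 * a\<close>, so
  \<open>tail_shift_integral\<close> applies on the product space; Fubini factors the limit.\<close>

lemma overshoot_integral_tendsto:
  "((\<lambda>x. (\<integral>p. indicator (low j a \<times> {\<omega>. psup \<omega> \<le> ereal a}) p *
       tail F (x - (psum (fst p) j + peak (snd p))) \<partial>(S \<Otimes>\<^sub>M S)) / tail F x) \<longlongrightarrow> low_mass j a) at_top"
proof -
  interpret SS: pair_prob_space S S ..
  let ?E = "low j a \<times> {\<omega>. psup \<omega> \<le> ereal a}"
  let ?Y = "\<lambda>p. psum (fst p) j + peak (snd p)"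
  have E [measurable]: "?E \<in> sets (S \<Otimes>\<^sub>M S)"
    by (intro pair_measureI sets_low sets_psup_le)
  have Y_le: "?Y p \<le> 2 * a" if "p \<in> ?E" for p
  proof -
    have "psum (fst p) j \<le> a" "peak (snd p) \<le> a"
      using that by (auto simp: low_def intro: peak_le)
    thus ?thesis
      by simp
  qed
  have "(\<integral>p. indicator ?E p * exp (\<gamma> * ?Y p) \<partial>(S \<Otimes>\<^sub>M S))
      = (\<integral>\<omega>. \<integral>\<omega>'. indicator ?E (\<omega>, \<omega>') * exp (\<gamma> * ?Y (\<omega>, \<omega>')) \<partial>S \<partial>S)"
  proof (rule SS.integral_fst'[symmetric], rule SS.integrable_const_bound)
    show "AE p in S \<Otimes>\<^sub>M S. norm (indicator ?E p * exp (\<gamma> * ?Y p)) \<le> exp (\<gamma> * (2 * a))"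
    proof (rule AE_I2)
      fix p
      have "exp (\<gamma> * ?Y p) \<le> exp (\<gamma> * (2 * a))" if "p \<in> ?E"
        using Y_le[OF that] \<gamma>_pos by (simp only: exp_le_cancel_iff mult_le_cancel_left_pos)
      thus "norm (indicator ?E p * exp (\<gamma> * ?Y p)) \<le> exp (\<gamma> * (2 * a))"
        by (cases "p \<in> ?E") auto
    qed
  qed measurable
  also have "\<dots> = (\<integral>\<omega>. \<integral>\<omega>'. (indicator (low j a) \<omega> * exp (\<gamma> * psum \<omega> j)) *
      (indicator {\<omega>. psup \<omega> \<le> ereal a} \<omega>' * exp (\<gamma> * peak \<omega>')) \<partial>S \<partial>S)"
    by (simp add: indicator_times distrib_left exp_add mult_ac)
  also have "\<dots> = low_mass j a"
    by (simp add: low_mass_def)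
  finally have eq: "(\<integral>p. indicator ?E p * exp (\<gamma> * ?Y p) \<partial>(S \<Otimes>\<^sub>M S)) = low_mass j a" .
  show ?thesis
    unfolding eq[symmetric]
    by (rule tail_shift_integral[OF SS.finite_measure_axioms E _ Y_le]) measurable
qed

text \<open>For i < j the event of index j forces S_{i+1} \<le> a, while that of index i forces
  S_{i+1} > x - a > a; hence the events are disjoint.\<close>

lemma measure_UN_overshoot_ge:
  assumes "x > 2 * a"
  shows "(\<Sum>j<n. measure S (overshoot j a x)) \<le> measure S (\<Union>j. overshoot j a x)"
proof -
  have "disjoint_family_on (\<lambda>j. overshoot j a x) {..<n}"
  proof (unfold disjoint_family_on_def, intro ballI impI)
    fix i j :: nat assume "i \<noteq> j"
    moreover have "overshoot i a x \<inter> overshoot j a x = {}" if "i < j" for i j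
    proof -
      have "psum \<omega> (Suc i) \<le> a" if "\<omega> \<in> overshoot j a x" for \<omega>
        using that \<open>i < j\<close> by (simp add: overshoot_def)
      moreover have "a < psum \<omega> (Suc i)" if "\<omega> \<in> overshoot i a x" for \<omega>
        using that assms by (simp add: overshoot_def)
      ultimately show ?thesis
        by force
    qed
    ultimately show "overshoot i a x \<inter> overshoot j a x = {}"
      by (metis inf_commute nat_neq_iff)
  qed
  hence "(\<Sum>j<n. measure S (overshoot j a x)) = measure S (\<Union>j<n. overshoot j a x)"
    by (intro seq.P.finite_measure_finite_Union[symmetric]) auto
  also have "\<dots> \<le> measure S (\<Union>j. overshoot j a x)"
    by (intro seq.P.finite_measure_mono) auto
  finally show ?thesis .
qed

text \<open>The target is the geometric series of the weights \<open>\<phi> ^ j * peak_mgf\<close>.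
  The choices are made in the order \<open>n\<close>, \<open>a\<close>, \<open>x\<close>; with only
  finitely many \<open>j\<close> in play, no uniformity in \<open>j\<close> is required.\<close>

lemma overshoot_lower:
  assumes "d < peak_mgf / (1 - \<phi>)"
  shows "\<exists>a>0. \<forall>\<^sub>F x in at_top. d < measure S (\<Union>j. overshoot j a x) / tail F x"
proof -
  have "(\<lambda>n. (\<Sum>j<n. \<phi> ^ j) * peak_mgf) \<longlonglongrightarrow> 1 / (1 - \<phi>) * peak_mgf"
    using geometric_sums[of \<phi>] \<phi>_nonneg \<phi>_less_1
    by (intro tendsto_mult tendsto_const) (auto simp: sums_def)
  hence "\<forall>\<^sub>F n in sequentially. d < (\<Sum>j<n. \<phi> ^ j) * peak_mgf"
    using assms by (intro order_tendstoD(1)) auto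
  then obtain n where n: "d < (\<Sum>j<n. \<phi> ^ j) * peak_mgf"
    using eventually_happens[of _ sequentially] by auto
  have "((\<lambda>a. \<Sum>j<n. low_mass j a) \<longlongrightarrow> (\<Sum>j<n. \<phi> ^ j * peak_mgf)) at_top"
    by (intro tendsto_sum low_mass_tendsto)
  hence "\<forall>\<^sub>F a in at_top. d < (\<Sum>j<n. low_mass j a) \<and> a > 0"
    using n by (intro eventually_conj order_tendstoD(1) eventually_gt_at_top)
      (auto simp: sum_distrib_right)
  then obtain a where a: "d < (\<Sum>j<n. low_mass j a)" "a > 0"
    using eventually_happens[of _ "at_top :: real filter"] by auto
  let ?f = "\<lambda>j x. (\<integral>p. indicator (low j a \<times> {\<omega>. psup \<omega> \<le> ereal a}) p *
       tail F (x - (psum (fst p) j + peak (snd p))) \<partial>(S \<Otimes>\<^sub>M S))"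
  have "((\<lambda>x. \<Sum>j<n. ?f j x / tail F x) \<longlongrightarrow> (\<Sum>j<n. low_mass j a)) at_top"
    by (intro tendsto_sum overshoot_integral_tendsto)
  from order_tendstoD(1)[OF this a(1)] eventually_gt_at_top[of "2 * a"]
  have "\<forall>\<^sub>F x in at_top. d < measure S (\<Union>j. overshoot j a x) / tail F x"
  proof eventually_elim
    case (elim x)
    note elim(1)
    also have "(\<Sum>j<n. ?f j x / tail F x) \<le> (\<Sum>j<n. measure S (overshoot j a x) / tail F x)"
      using tail_pos[of x] by (intro sum_mono divide_right_mono measure_overshoot_ge) auto
    also have "\<dots> = (\<Sum>j<n. measure S (overshoot j a x)) / tail F x"
      by (simp add: sum_divide_distrib)
    also have "\<dots> \<le> measure S (\<Union>j. overshoot j a x) / tail F x"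
      using tail_pos[of x] elim(2) by (intro divide_right_mono measure_UN_overshoot_ge) auto
    finally show ?case .
  qed
  with a show ?thesis
    by blast
qed

lemma UN_overshoot_le_exceed_prob: "measure S (\<Union>j. overshoot j a x) \<le> exceed_prob UNIV x"
  unfolding exceed_prob_def by (intro seq.P.finite_measure_mono sets_exceed) (auto simp: overshoot_def exceed_def)

lemma exceed_prob_UNIV_tendsto: "((\<lambda>x. exceed_prob UNIV x / tail F x) \<longlongrightarrow> peak_mgf / (1 - \<phi>)) at_top"
proof (rule order_tendstoI)
  fix d assume "d < peak_mgf / (1 - \<phi>)"
  from overshoot_lower[OF this] obtain a
    where "\<forall>\<^sub>F x in at_top. d < measure S (\<Union>j. overshoot j a x) / tail F x"
    by blast
  thus "\<forall>\<^sub>F x in at_top. d < exceed_prob UNIV x / tail F x"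
  proof eventually_elim
    case (elim x)
    also have "measure S (\<Union>j. overshoot j a x) / tail F x \<le> exceed_prob UNIV x / tail F x"
      using tail_pos[of x] by (intro divide_right_mono UN_overshoot_le_exceed_prob) auto
    finally show ?case .
  qed
qed (rule exceed_prob_UNIV_upper)

end

section \<open>Transfer to the given random walk\<close>

lemma walk_eq_psum: "walk \<xi> n \<omega> = psum (\<lambda>i. \<xi> (Suc i) \<omega>) n"
  by (simp add: walk_def psum_def sum.atLeast1_atMost_eq)

lemma walk_sup_eq_psup: "walk_sup \<xi> \<omega> = psup (\<lambda>i. \<xi> (Suc i) \<omega>)"
  by (simp add: walk_sup_def psup_def walk_eq_psum)

lemma walk_max_le_iff: "walk_max \<xi> n \<omega> \<le> a \<longleftrightarrow> (\<forall>k\<le>n. psum (\<lambda>i. \<xi> (Suc i) \<omega>) k \<le> a)"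
  unfolding walk_max_def by (subst Max_le_iff) (auto simp: walk_eq_psum)

text \<open>Independence turns the joint law on \<open>{1..}\<close> into a product measure, and
  reindexing by the injection \<open>Suc\<close> moves it to all of \<open>nat\<close>.\<close>

lemma (in prob_space) distr_iid_sequence:
  assumes indep: "indep_vars (\<lambda>_. borel) \<xi> {1..}"
    and D: "\<And>n. n \<ge> 1 \<Longrightarrow> distr M borel (\<xi> n) = (D :: real measure)"
  shows "(\<lambda>\<omega> i. \<xi> (Suc i) \<omega>) \<in> measurable M (\<Pi>\<^sub>M i\<in>UNIV. borel)"
    and "distr M (\<Pi>\<^sub>M i\<in>UNIV. borel) (\<lambda>\<omega> i. \<xi> (Suc i) \<omega>) = (\<Pi>\<^sub>M i\<in>(UNIV::nat set). D)"
proof -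
  have rv: "random_variable borel (\<xi> (Suc i))" for i
    using indep by (auto simp: indep_vars_def)
  show "(\<lambda>\<omega> i. \<xi> (Suc i) \<omega>) \<in> measurable M (\<Pi>\<^sub>M i\<in>UNIV. borel)"
    by (intro measurable_PiM_single') (auto intro: rv)
  let ?B = "\<Pi>\<^sub>M i\<in>{1..}. borel" and ?U = "\<Pi>\<^sub>M i\<in>(UNIV::nat set). (borel :: real measure)"
  let ?X = "\<lambda>\<omega>. \<lambda>i\<in>{1..}. \<xi> i \<omega>" and ?t = "\<lambda>\<omega>. \<lambda>n\<in>(UNIV::nat set). \<omega> (Suc n)"
  have rv': "random_variable borel (\<xi> i)" if "i \<in> {1..}" for i
    using indep that by (auto simp: indep_vars_def)
  have X: "?X \<in> measurable M ?B"
    by (intro measurable_restrict rv')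
  have t: "?t \<in> measurable ?B ?U"
    by (intro measurable_restrict measurable_component_singleton) auto
  have "distr M ?U (\<lambda>\<omega> i. \<xi> (Suc i) \<omega>) = distr (distr M ?B ?X) ?U ?t"
    by (subst distr_distr[OF t X]) (auto intro!: distr_cong simp: fun_eq_iff)
  also have "distr M ?B ?X = (\<Pi>\<^sub>M i\<in>{1..}. distr M borel (\<xi> i))"
    using indep by (subst (asm) indep_vars_iff_distr_eq_PiM') (auto intro: rv')
  also have "\<dots> = (\<Pi>\<^sub>M i\<in>{1..}. D)"
    by (intro PiM_cong) (auto simp: D)
  also have "distr (\<Pi>\<^sub>M i\<in>{1..}. D) ?U ?t = distr (\<Pi>\<^sub>M i\<in>{1..}. D) (\<Pi>\<^sub>M i\<in>UNIV. D) ?t"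
    using D[of 1] by (intro distr_cong sets_PiM_cong) auto
  also have "\<dots> = (\<Pi>\<^sub>M i\<in>UNIV. D)"
    using D[of 1] prob_space_distr[OF rv'[of 1]] by (intro distr_PiM_reindex) auto
  finally show "distr M ?U (\<lambda>\<omega> i. \<xi> (Suc i) \<omega>) = (\<Pi>\<^sub>M i\<in>(UNIV::nat set). D)" .
qed

theorem theorem1:
  fixes \<gamma> \<epsilon> :: real and F :: "real \<Rightarrow> real"
    and P :: "'a measure" and \<xi> :: "nat \<Rightarrow> 'a \<Rightarrow> real"
  assumes "\<gamma> > 0"
    and "distribution_function F"
    and "F \<in> class_S \<gamma>"
    and "mgf F \<gamma> < 1"
    and "prob_space P"
    and "prob_space.indep_vars P (\<lambda>_. borel) \<xi> {1..}"
    and "\<And>n. n \<ge> 1 \<Longrightarrow> cdf (distr P borel (\<xi> n)) = F"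
    and "\<epsilon> > 0"
  shows "\<exists>a>0. \<exists>L::real.
      ereal (1 - \<epsilon>) *
          enn2ereal ((\<integral>\<^sup>+\<omega>. exp_ereal (ereal \<gamma> * walk_sup \<xi> \<omega>) \<partial>P) / (1 - mgf F \<gamma>))
        \<le> Liminf at_top (\<lambda>x. ereal (1 / tail F x *
             measure P ({\<omega> \<in> space P. walk_sup \<xi> \<omega> > ereal x} \<inter>
                        (\<Union>n\<in>{1..}. crossing_event P \<xi> n a (x - a))))) \<and>
      Liminf at_top (\<lambda>x. ereal (1 / tail F x *
             measure P ({\<omega> \<in> space P. walk_sup \<xi> \<omega> > ereal x} \<inter>
                        (\<Union>n\<in>{1..}. crossing_event P \<xi> n a (x - a)))))
        \<le> ereal L \<and>
      ((\<lambda>x. measure P {\<omega> \<in> space P. walk_sup \<xi> \<omega> > ereal x} / tail F x) \<longlongrightarrow> L) at_top \<and>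
      ereal L = enn2ereal ((\<integral>\<^sup>+\<omega>. exp_ereal (ereal \<gamma> * walk_sup \<xi> \<omega>) \<partial>P) / (1 - mgf F \<gamma>))"
proof -
  interpret P: prob_space P by fact
  interpret conv_equiv_walk F \<gamma>
    using assms by unfold_locales
  let ?R = "\<Pi>\<^sub>M i\<in>(UNIV::nat set). (borel :: real measure)"
  define Z where "Z = (\<lambda>\<omega> i. \<xi> (Suc i) \<omega>)"
  have "distr P borel (\<xi> n) = \<mu>" if "n \<ge> 1" for n
  proof (rule cdf_unique)
    have "P.random_variable borel (\<xi> n)"
      using assms(6) that by (auto simp: P.indep_vars_def)
    thus "real_distribution (distr P borel (\<xi> n))"
      by simp
  qed (use assms(7)[OF that] cdf_\<mu> real_distribution_\<mu> in auto)
  note * = P.distr_iid_sequence[OF assms(6) this]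
  have Z [measurable]: "Z \<in> measurable P ?R" and dist: "distr P ?R Z = S"
    using * by (auto simp: Z_def)
  have sets_R: "X \<in> sets ?R \<longleftrightarrow> X \<in> sets S" for X
    using sets_S by simp
  have transfer: "measure P {\<omega> \<in> space P. Z \<omega> \<in> X} = measure S X" if "X \<in> sets S" for X
  proof -
    have "measure S X = measure (distr P ?R Z) X"
      by (simp only: dist)
    also have "\<dots> = measure P (Z -` X \<inter> space P)"
      using that sets_R by (intro measure_distr Z) auto
    finally show ?thesis
      by (simp add: vimage_def Int_def conj_commute)
  qed
  have sup: "measure P {\<omega> \<in> space P. walk_sup \<xi> \<omega> > ereal x} = exceed_prob UNIV x" for x
    unfolding exceed_prob_def transfer[OF sets_exceed, symmetric]
    by (simp add: walk_sup_eq_psup less_psup_iff exceed_def Z_def)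
  have union: "measure P ({\<omega> \<in> space P. walk_sup \<xi> \<omega> > ereal x} \<inter>
      (\<Union>n\<in>{1..}. crossing_event P \<xi> n a (x - a))) = measure S (\<Union>j. overshoot j a x)" for a x
  proof -
    \<comment> \<open>With \<open>n = Suc j\<close> the maximum up to \<open>n - 1\<close> in
      \<open>crossing_event\<close> becomes the maximum up to \<open>j\<close> in
      \<open>overshoot\<close>.\<close>
    have "(\<Union>n\<in>{1..}. crossing_event P \<xi> n a (x - a)) = (\<Union>j. crossing_event P \<xi> (Suc j) a (x - a))"
      by (auto simp: Suc_le_eq gr0_conv_Suc)
    hence "{\<omega> \<in> space P. walk_sup \<xi> \<omega> > ereal x} \<inter>
        (\<Union>n\<in>{1..}. crossing_event P \<xi> n a (x - a)) = {\<omega> \<in> space P. Z \<omega> \<in> (\<Union>j. overshoot j a x)}"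
      by (auto simp: crossing_event_def overshoot_def walk_max_le_iff walk_eq_psum
          walk_sup_eq_psup less_psup_iff Z_def)
    moreover have "(\<Union>j. overshoot j a x) \<in> sets S"
      by (intro sets.countable_UN image_subsetI sets_overshoot)
    ultimately show ?thesis
      by (simp only: transfer)
  qed
  have "(\<integral>\<^sup>+\<omega>. exp_ereal (ereal \<gamma> * walk_sup \<xi> \<omega>) \<partial>P) = (\<integral>\<^sup>+\<omega>. exp_ereal (ereal \<gamma> * psup (Z \<omega>)) \<partial>P)"
    by (simp add: walk_sup_eq_psup Z_def)
  also have "\<dots> = (\<integral>\<^sup>+\<omega>. exp_ereal (ereal \<gamma> * psup \<omega>) \<partial>distr P ?R Z)"
    by (intro nn_integral_distr[symmetric]) measurable
  also have "\<dots> = ennreal peak_mgf"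
    by (simp only: dist nn_integral_exp_psup)
  finally have num: "(\<integral>\<^sup>+\<omega>. exp_ereal (ereal \<gamma> * walk_sup \<xi> \<omega>) \<partial>P) = ennreal peak_mgf" .
  define L where "L = peak_mgf / (1 - \<phi>)"
  have "L > 0"
    using peak_mgf_ge_1 \<phi>_less_1 by (simp add: L_def)
  \<comment> \<open>Truncated subtraction and extended division agree with the real operations here
    because \<open>\<phi> < 1\<close>.\<close>
  have "ennreal peak_mgf / (1 - mgf F \<gamma>) = ennreal L"
    using \<phi>_nonneg \<phi>_less_1 peak_mgf_ge_1
    by (simp add: mgf_eq L_def divide_ennreal ennreal_minus flip: ennreal_1)
  hence L: "enn2ereal ((\<integral>\<^sup>+\<omega>. exp_ereal (ereal \<gamma> * walk_sup \<xi> \<omega>) \<partial>P) / (1 - mgf F \<gamma>)) = ereal L"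
    using \<open>L > 0\<close> by (simp add: num enn2ereal_ennreal)
  \<comment> \<open>The inequality is strict because both \<open>\<epsilon>\<close> and
    \<open>L\<close> are positive, so \<open>overshoot_lower\<close> supplies the required
    \<open>a\<close>.\<close>
  have "(1 - \<epsilon>) * L < peak_mgf / (1 - \<phi>)"
    using \<open>L > 0\<close> assms(8) by (simp add: L_def[symmetric])
  from overshoot_lower[OF this] obtain a where a: "a > 0"
    "\<forall>\<^sub>F x in at_top. (1 - \<epsilon>) * L < measure S (\<Union>j. overshoot j a x) / tail F x"
    by blast
  let ?g = "\<lambda>x. ereal (1 / tail F x * measure S (\<Union>j. overshoot j a x))"
  have lower: "ereal (1 - \<epsilon>) * ereal L \<le> Liminf at_top ?g"
    using a(2) by (intro Liminf_bounded) (auto elim!: eventually_mono)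
  have "Liminf at_top ?g \<le> Liminf at_top (\<lambda>x. ereal (exceed_prob UNIV x / tail F x))"
    using UN_overshoot_le_exceed_prob tail_pos
    by (intro Liminf_mono always_eventually allI) (simp add: divide_right_mono less_imp_le)
  also have "\<dots> = ereal L"
    using exceed_prob_UNIV_tendsto by (intro lim_imp_Liminf) (auto simp: L_def)
  finally have upper: "Liminf at_top ?g \<le> ereal L" .
  show ?thesis
    unfolding L union sup
    using a(1) lower upper exceed_prob_UNIV_tendsto by (intro exI[of _ a] exI[of _ L]) (simp add: L_def)
qed

end
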